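(* Consider a non-degenerate conditional disclosure of secrets (CDS) instance with characteristic graph $G_f(V,E)$. The capacity of CDS for this instance is $C = 1/2$ if and only if, within any qualified component of $G_f$, there is no internal qualified edge in an unqualified path (i.e., there do not exist a qualified component $Q$ of $G_f$ and an unqualified path all of whose vertices lie in $Q$ such that some two vertices of the path are joined by a qualified edge).
   Context: CDS instance. Let $X,Y$ be positive integers, $\mathcal{I}\subset\{1,\dots,X\}\times\{1,\dots,Y\}$, and $f:\mathcal{I}\to\{0,1\}$. CDS scheme. A scheme consists of a finite field $\mathbb{F}_p$, integers $L\ge 1$ and $L_Z\ge 0$, a secret $S$ consisting of $L$ i.i.d. uniform symbols of $\mathbb{F}_p$, a noise variable $Z$ consisting of $L_Z$ i.i.d. uniform symbols of $\mathbb{F}_p$ and independent of $S$, and signals $A_1,\dots,A_X,B_1,\dots,B_Y$, each a deterministic function of $(S,Z)$, where $A_x$ takes values in $\mathbb{F}_p^{L_{A_x}}$ and $B_y$ in $\mathbb{F}_p^{L_{B_y}}$. Entropy $H$ is measured in $p$-ary units, so $H(S)=L$, $H(Z)=L_Z$. The scheme must satisfy for all $(x,y)\in\mathcal{I}$: (correctness) $H(S\mid A_x,B_y)=0$ if $f(x,y)=1$; (security) $H(S\mid A_x,B_y)=H(S)$ if $f(x,y)=0$. The parameters $p, L, L_Z$ and the signal lengths may be chosen freely. Capacity. The tuple $(L/L_{A_1},\dots,L/L_{A_X},L/L_{B_1},\dots,L/L_{B_Y})$ of a scheme is called achievable; the closure of the set of achievable tuples is the capacity region $\mathcal{C}$.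 A communication rate $R = L/(2N)$ is achievable if the symmetric tuple $(L/N,\dots,L/N)$ lies in $\mathcal{C}$, and the capacity $C$ is the supremum of achievable rates. Characteristic graph. $G_f(V,E)$ is the undirected bipartite graph with $V=\{A_1,\dots,A_X,B_1,\dots,B_Y\}$ and $E=\{\{A_x,B_y\}:(x,y)\in\mathcal{I}\}$. An edge $\{A_x,B_y\}$ is qualified if $f(x,y)=1$ and unqualified if $f(x,y)=0$. A qualified (unqualified) path is a sequence of distinct connecting qualified (unqualified) edges. An internal qualified edge of an unqualified path is a qualified edge that connects two vertices of that path. A qualified component is a maximal induced subgraph of $G_f$ such that any two vertices in the subgraph are connected by a qualified path (a single vertex incident to no qualified edge is a trivial qualified component). The instance is non-degenerate if every vertex is incident to at least one unqualified edge.
   Formalization: The formal statement assumes that at least one qualified edge exists; if f = 0 on all of I, constant signals give infinite capacity while the graph condition holds vacuously, so the claim as stated fails there. *)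

theory Defs
  imports "HOL-Probability.Probability" "HOL-Algebra.Ring"
begin

text \<open>
  A CDS instance is given by a set \<open>I :: ('x \<times> 'y) set\<close> of input pairs and
  \<open>f :: 'x \<times> 'y \<Rightarrow> bool\<close>, where only the values of \<open>f\<close> on \<open>I\<close> are used and \<open>True\<close> stands
  for 1. The inputs \<open>x\<close> and \<open>y\<close> range over the finite types \<open>'x\<close> and \<open>'y\<close> (so that
  \<open>X = CARD('x) \<ge> 1\<close> and \<open>Y = CARD('y) \<ge> 1\<close>). The signals, which are also the vertices of
  the characteristic graph, are indexed by \<open>'x + 'y\<close>: \<open>Inl x\<close> is \<open>A\<^sub>x\<close> and \<open>Inr y\<close> is \<open>B\<^sub>y\<close>.
\<close>

section \<open>Schemes\<close>

text \<open>
  A vector of length \<open>n\<close> over \<open>F\<close> is an extensional function on \<open>{..<n}\<close>; the measure below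
  makes its \<open>n\<close> entries independent and uniform. Finite fields are taken with carriers in
  \<open>int\<close>, which covers every finite field up to isomorphism.
\<close>

type_synonym vec = "nat \<Rightarrow> int"

definition iid_symbols :: "int ring \<Rightarrow> nat \<Rightarrow> vec measure" where
  "iid_symbols F n = Pi\<^sub>M {..<n} (\<lambda>_. uniform_count_measure (carrier F))"

text \<open>
  The joint distribution of the secret \<open>S\<close> and the noise \<open>Z\<close>. On this sample space \<open>S\<close> is
  the random variable \<open>fst\<close>, and a signal, being a function of \<open>(S, Z)\<close>, is a function on
  the sample space.
\<close>

definition source :: "int ring \<Rightarrow> nat \<Rightarrow> nat \<Rightarrow> (vec \<times> vec) measure" where
  "source F L LZ = iid_symbols F L \<Otimes>\<^sub>M iid_symbols F LZ"

definition discrete_entropy :: "real \<Rightarrow> 'a measure \<Rightarrow> ('a \<Rightarrow> 'b) \<Rightarrow> real" where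
  "discrete_entropy b M U = prob_space.entropy M b (count_space (U ` space M)) U"

definition discrete_cond_entropy ::
    "real \<Rightarrow> 'a measure \<Rightarrow> ('a \<Rightarrow> 'b) \<Rightarrow> ('a \<Rightarrow> 'c) \<Rightarrow> real" where
  "discrete_cond_entropy b M U W =
     prob_space.conditional_entropy M b
       (count_space (U ` space M)) (count_space (W ` space M)) U W"

text \<open>
  \<open>N v\<close> is the length of the signal \<open>\<sigma> v\<close>. Lengths are positive, so that every ratio
  \<open>L / N v\<close> is a real number.
\<close>

definition cds_scheme ::
    "('x \<times> 'y) set \<Rightarrow> ('x \<times> 'y \<Rightarrow> bool) \<Rightarrow> int ring \<Rightarrow> nat \<Rightarrow> nat \<Rightarrow>
     ('x + 'y \<Rightarrow> nat) \<Rightarrow> ('x + 'y \<Rightarrow> vec \<times> vec \<Rightarrow> vec) \<Rightarrow> bool" where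
  "cds_scheme I f F L LZ N \<sigma> \<longleftrightarrow>
     field F \<and> finite (carrier F) \<and> L \<ge> 1 \<and>
     (\<forall>v. N v \<ge> 1 \<and> \<sigma> v \<in> space (source F L LZ) \<rightarrow> ({..<N v} \<rightarrow>\<^sub>E carrier F)) \<and>
     (let p = real (card (carrier F)); M = source F L LZ;
          H_S = discrete_entropy p M fst;
          H_S_given = (\<lambda>x y. discrete_cond_entropy p M fst (\<lambda>\<omega>. (\<sigma> (Inl x) \<omega>, \<sigma> (Inr y) \<omega>)))
      in \<forall>(x, y) \<in> I. (f (x, y) \<longrightarrow> H_S_given x y = 0) \<and>
                      (\<not> f (x, y) \<longrightarrow> H_S_given x y = H_S))"

section \<open>Capacity\<close>

definition achievable_tuples ::
    "('x::finite \<times> 'y::finite) set \<Rightarrow> ('x \<times> 'y \<Rightarrow> bool) \<Rightarrow> (real ^ ('x + 'y)) set" where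
  "achievable_tuples I f =
     {\<chi> v. real L / real (N v) | L N. \<exists>F LZ \<sigma>. cds_scheme I f F L LZ N \<sigma>}"

definition capacity_region ::
    "('x::finite \<times> 'y::finite) set \<Rightarrow> ('x \<times> 'y \<Rightarrow> bool) \<Rightarrow> (real ^ ('x + 'y)) set" where
  "capacity_region I f = closure (achievable_tuples I f)"

definition achievable_rates ::
    "('x::finite \<times> 'y::finite) set \<Rightarrow> ('x \<times> 'y \<Rightarrow> bool) \<Rightarrow> real set" where
  "achievable_rates I f =
     {real L / (2 * real N) | L N :: nat.
        L \<ge> 1 \<and> N \<ge> 1 \<and> (\<chi> v. real L / real N) \<in> capacity_region I f}"

text \<open>
  The supremum is taken in the extended reals: the rates are unbounded if no input pair is
  qualified.
\<close>

definition cds_capacity ::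
    "('x::finite \<times> 'y::finite) set \<Rightarrow> ('x \<times> 'y \<Rightarrow> bool) \<Rightarrow> ereal" where
  "cds_capacity I f = (SUP R \<in> achievable_rates I f. ereal R)"

section \<open>The characteristic graph\<close>

definition graph_edges :: "('x \<times> 'y) set \<Rightarrow> ('x + 'y) set set" where
  "graph_edges I = (\<lambda>(x, y). {Inl x, Inr y}) ` I"

definition qualified_edges :: "('x \<times> 'y) set \<Rightarrow> ('x \<times> 'y \<Rightarrow> bool) \<Rightarrow> ('x + 'y) set set" where
  "qualified_edges I f = graph_edges {e \<in> I. f e}"

definition unqualified_edges :: "('x \<times> 'y) set \<Rightarrow> ('x \<times> 'y \<Rightarrow> bool) \<Rightarrow> ('x + 'y) set set" where
  "unqualified_edges I f = graph_edges {e \<in> I. \<not> f e}"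

text \<open>
  A path is represented by the list of vertices it visits. Its edges, not its vertices, are
  required to be distinct; a single vertex is a path without edges.
\<close>

definition path_edges :: "'v list \<Rightarrow> 'v set list" where
  "path_edges vs = map2 (\<lambda>u w. {u, w}) vs (tl vs)"

definition is_path :: "'v set set \<Rightarrow> 'v list \<Rightarrow> bool" where
  "is_path E vs \<longleftrightarrow> vs \<noteq> [] \<and> set (path_edges vs) \<subseteq> E \<and> distinct (path_edges vs)"

definition qualified_connected ::
    "('x \<times> 'y) set \<Rightarrow> ('x \<times> 'y \<Rightarrow> bool) \<Rightarrow> ('x + 'y) set \<Rightarrow> bool" where
  "qualified_connected I f Q \<longleftrightarrow>
     (\<forall>u \<in> Q. \<forall>w \<in> Q. \<exists>vs. is_path (qualified_edges I f) vs \<and> hd vs = u \<and> last vs = w)"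

text \<open>An induced subgraph is identified with its vertex set.\<close>

definition qualified_component ::
    "('x \<times> 'y) set \<Rightarrow> ('x \<times> 'y \<Rightarrow> bool) \<Rightarrow> ('x + 'y) set \<Rightarrow> bool" where
  "qualified_component I f Q \<longleftrightarrow>
     qualified_connected I f Q \<and> (\<forall>Q'. Q \<subset> Q' \<longrightarrow> \<not> qualified_connected I f Q')"

definition internal_qualified_edge ::
    "('x \<times> 'y) set \<Rightarrow> ('x \<times> 'y \<Rightarrow> bool) \<Rightarrow> ('x + 'y) list \<Rightarrow> ('x + 'y) set \<Rightarrow> bool" where
  "internal_qualified_edge I f vs e \<longleftrightarrow> e \<in> qualified_edges I f \<and> e \<subseteq> set vs"

definition non_degenerate :: "('x \<times> 'y) set \<Rightarrow> ('x \<times> 'y \<Rightarrow> bool) \<Rightarrow> bool" where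
  "non_degenerate I f \<longleftrightarrow> (\<forall>v. \<exists>e \<in> unqualified_edges I f. v \<in> e)"

end

theory Submission
  imports Defs "HOL-Number_Theory.Residues"
begin

text \<open>
  Converse. Let \<open>d\<close> bound the excess of the signal lengths over \<open>L\<close>. For a qualified edge, correctness
  and the independence of each single signal from the secret \<open>S\<close> give \<open>H(u | w, S) \<le> d\<close>, so the
  signals of a qualified component determine each other given \<open>S\<close>, up to \<open>O(d)\<close>. On an unqualified edge
  security allows the conditioning on \<open>S\<close> to be dropped, hence \<open>H(u | w) = O(d)\<close> for the vertices of an
  unqualified path inside a qualified component. An internal qualified edge has \<open>H(u | w) \<ge> L\<close>, so
  \<open>d\<close> is at least a fixed fraction of \<open>L\<close>.

  Achievability. With \<open>L = 1\<close> over a large prime field, let \<open>v\<close> send \<open>c\<^sub>v s + z\<^sub>Q\<close>, where every qualified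
  component \<open>Q\<close> has its own noise symbol \<open>z\<^sub>Q\<close> and \<open>c\<^sub>v\<close> identifies the class of \<open>v\<close> under unqualified
  paths inside \<open>Q\<close>. The ends of a qualified edge then have the same noise and different coefficients;
  those of an unqualified edge send the same signal or use independent noises.
\<close>

section \<open>Entropy of simple functions\<close>

text \<open>Change of variables for the law of \<open>X\<close>. Sums over the ranges of different
  variables become integrals over one sample space and can then be combined.\<close>

lemma (in information_space) sum_prob_simple_function:
  assumes X: "simple_function M X"
  shows "(\<Sum>x\<in>X ` space M. prob (X -` {x} \<inter> space M) * g x) = (\<integral>\<omega>. (g (X \<omega>) :: real) \<partial>M)"
proof -
  note D = simple_distributed[OF simple_distributedI[OF X measure_nonneg refl]]
  have "finite (X ` space M)"
    using X by (rule simple_functionD)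
  then have "(\<Sum>x\<in>X ` space M. prob (X -` {x} \<inter> space M) * g x) =
      (\<integral>x. prob (X -` {x} \<inter> space M) * g x \<partial>count_space (X ` space M))"
    by (simp add: lebesgue_integral_count_space_finite)
  also have "\<dots> = (\<integral>\<omega>. g (X \<omega>) \<partial>M)"
    by (rule distributed_integral[OF D]) auto
  finally show ?thesis .
qed

lemma (in information_space) entropy_eq_expectation:
  assumes X: "simple_function M X"
  shows "\<H>(X) = - (\<integral>\<omega>. log b (prob (X -` {X \<omega>} \<inter> space M)) \<partial>M)"
  using entropy_simple_distributed[OF simple_distributedI[OF X measure_nonneg refl]]
  by (simp add: sum_prob_simple_function[OF X, where g = "\<lambda>x. log b (prob (X -` {x} \<inter> space M))"])

text \<open>Splitting the logarithm of the quotient gives four sums. Each is the expectation of the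
  logarithm of one joint or marginal mass, hence an entropy up to sign.\<close>

lemma (in information_space) conditional_mutual_information_eq_entropy:
  assumes X: "simple_function M X" and Y: "simple_function M Y" and Z: "simple_function M Z"
  shows "\<I>(X ; Y | Z) =
    \<H>(\<lambda>\<omega>. (X \<omega>, Z \<omega>)) + \<H>(\<lambda>\<omega>. (Y \<omega>, Z \<omega>)) - \<H>(\<lambda>\<omega>. (X \<omega>, Y \<omega>, Z \<omega>)) - \<H>(Z)"
proof -
  let ?V = "\<lambda>\<omega>. (X \<omega>, Y \<omega>, Z \<omega>)"
  define pxyz where "pxyz t = prob (?V -` {t} \<inter> space M)" for t
  define pxz where "pxz t = prob ((\<lambda>\<omega>. (X \<omega>, Z \<omega>)) -` {t} \<inter> space M)" for t
  define pyz where "pyz t = prob ((\<lambda>\<omega>. (Y \<omega>, Z \<omega>)) -` {t} \<inter> space M)" for t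
  define pz where "pz t = prob (Z -` {t} \<inter> space M)" for t
  note SP = simple_function_Pair
  note V = SP[OF X SP[OF Y Z]]
  \<comment> \<open>Positive joint mass forces positive marginal masses, which permits splitting the
    logarithm; terms of zero joint mass vanish.\<close>
  have le: "pxyz (x, y, z) \<le> pxz (x, z)" "pxyz (x, y, z) \<le> pyz (y, z)" "pxyz (x, y, z) \<le> pz z" for x y z
    unfolding pxyz_def pxz_def pyz_def pz_def
    using simple_functionD(2)[OF SP[OF X Z]] simple_functionD(2)[OF SP[OF Y Z]] simple_functionD(2)[OF Z]
    by (auto intro!: finite_measure_mono)
  have "\<I>(X ; Y | Z) = (\<Sum>(x, y, z)\<in>?V ` space M.
      pxyz (x, y, z) * log b (pxyz (x, y, z) / (pxz (x, z) * (pyz (y, z) / pz z))))"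
    unfolding pxyz_def pxz_def pyz_def pz_def
    by (intro conditional_mutual_information_eq simple_distributedI X Y Z SP measure_nonneg refl)
  also have "\<dots> = (\<Sum>t\<in>?V ` space M. pxyz t * log b (pxyz t))
      - (\<Sum>t\<in>?V ` space M. pxyz t * (\<lambda>(x, y, z). log b (pxz (x, z))) t)
      - (\<Sum>t\<in>?V ` space M. pxyz t * (\<lambda>(x, y, z). log b (pyz (y, z))) t)
      + (\<Sum>t\<in>?V ` space M. pxyz t * (\<lambda>(x, y, z). log b (pz z)) t)"
    unfolding sum_subtractf[symmetric] sum.distrib[symmetric]
  proof (rule sum.cong[OF refl], clarsimp)
    fix \<omega>
    let ?x = "X \<omega>" and ?y = "Y \<omega>" and ?z = "Z \<omega>"
    show "pxyz (?x, ?y, ?z) * log b (pxyz (?x, ?y, ?z) * pz ?z / (pxz (?x, ?z) * pyz (?y, ?z))) =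
       pxyz (?x, ?y, ?z) * log b (pxyz (?x, ?y, ?z)) - pxyz (?x, ?y, ?z) * log b (pxz (?x, ?z)) -
       pxyz (?x, ?y, ?z) * log b (pyz (?y, ?z)) + pxyz (?x, ?y, ?z) * log b (pz ?z)"
    proof (cases "pxyz (?x, ?y, ?z) = 0")
      case False
      then have "0 < pxyz (?x, ?y, ?z)"
        by (simp add: pxyz_def zero_less_measure_iff)
      with le[of ?x ?y ?z] show ?thesis
        by (simp add: log_mult log_divide algebra_simps)
    qed simp
  qed
  also have "\<dots> = - \<H>(?V) + \<H>(\<lambda>\<omega>. (X \<omega>, Z \<omega>)) + \<H>(\<lambda>\<omega>. (Y \<omega>, Z \<omega>)) - \<H>(Z)"
    unfolding pxyz_def sum_prob_simple_function[OF V]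
    by (simp add: entropy_eq_expectation X Y Z SP pxz_def pyz_def pz_def)
  finally show ?thesis
    by simp
qed

text \<open>This is data processing, with the dependence of \<open>X\<close> on \<open>Y\<close>
  expressed through fibres so that no connecting function has to be supplied.\<close>

lemma (in information_space) entropy_mono:
  assumes Y: "simple_function M Y" and "simple_function M X"
    and fac: "\<And>\<omega> \<omega>'. \<omega> \<in> space M \<Longrightarrow> \<omega>' \<in> space M \<Longrightarrow> Y \<omega> = Y \<omega>' \<Longrightarrow> X \<omega> = X \<omega>'"
  shows "\<H>(X) \<le> \<H>(Y)"
proof -
  \<comment> \<open>\<open>g\<close> evaluates \<open>X\<close> at some sample in the fibre of
    \<open>Y\<close>; by \<open>fac\<close> the choice of sample does not matter.\<close>
  define g where "g y = X (SOME \<omega>. \<omega> \<in> space M \<and> Y \<omega> = y)" for y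
  have g: "(g \<circ> Y) \<omega> = X \<omega>" if "\<omega> \<in> space M" for \<omega>
  proof -
    have "(SOME \<omega>'. \<omega>' \<in> space M \<and> Y \<omega>' = Y \<omega>) \<in> space M \<and>
        Y (SOME \<omega>'. \<omega>' \<in> space M \<and> Y \<omega>' = Y \<omega>) = Y \<omega>"
      by (rule someI[where x = \<omega>]) (simp add: that)
    with fac[of "SOME \<omega>'. \<omega>' \<in> space M \<and> Y \<omega>' = Y \<omega>" \<omega>] that show ?thesis
      by (simp add: g_def)
  qed
  have im: "(g \<circ> Y) ` space M = X ` space M"
    by (rule image_cong[OF refl g])
  \<comment> \<open>The two variables agree only on \<open>space M\<close>, so the equality goes
    through their ranges and distributions.\<close>
  have "\<H>(X) = \<H>(g \<circ> Y)"
    unfolding entropy_def im by (intro arg_cong[where f = uminus] arg_cong2[where f = "KL_divergence b"] refl distr_cong) (use g in auto)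
  also have "\<dots> \<le> \<H>(Y)"
    by (rule entropy_data_processing[OF Y])
  finally show ?thesis .
qed

text \<open>Entropy sees only the partition of the sample space into fibres, so regrouping or
  reordering a tuple does not change it.\<close>

lemma (in information_space) entropy_cong_fibres:
  assumes "simple_function M X" "simple_function M Y"
    and "\<And>\<omega> \<omega>'. \<omega> \<in> space M \<Longrightarrow> \<omega>' \<in> space M \<Longrightarrow> X \<omega> = X \<omega>' \<longleftrightarrow> Y \<omega> = Y \<omega>'"
  shows "\<H>(X) = \<H>(Y)"
  by (rule antisym; rule entropy_mono) (use assms in auto)

text \<open>A restatement of the nonnegativity of \<open>\<I>(X ; Y | Z)\<close>, which drives the
  converse.\<close>

lemma (in information_space) entropy_submodular:
  assumes "simple_function M X" "simple_function M Y" "simple_function M Z"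
  shows "\<H>(\<lambda>\<omega>. (X \<omega>, Y \<omega>, Z \<omega>)) + \<H>(Z) \<le> \<H>(\<lambda>\<omega>. (X \<omega>, Z \<omega>)) + \<H>(\<lambda>\<omega>. (Y \<omega>, Z \<omega>))"
  using conditional_mutual_information_nonneg[OF assms] conditional_mutual_information_eq_entropy[OF assms]
  by simp

lemma (in information_space) entropy_le_log_card:
  assumes "simple_function M X" "finite A" "X ` space M \<subseteq> A"
  shows "\<H>(X) \<le> log b (card A)"
proof -
  have "0 < card (X ` space M)"
    using not_empty assms by (simp add: card_gt_0_iff simple_functionD(1))
  moreover have "card (X ` space M) \<le> card A"
    using assms by (intro card_mono)
  ultimately have "log b (card (X ` space M)) \<le> log b (card A)"
    using b_gt_1 by simp
  with entropy_le_card[OF simple_distributedI[OF assms(1) measure_nonneg refl]] show ?thesis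
    by linarith
qed

lemma (in information_space) entropy_const:
  "\<H>(\<lambda>_. c) = 0"
  using not_empty by (simp add: entropy_eq_expectation prob_space)

lemma (in information_space) entropy_equiprobable:
  assumes X: "simple_function M X"
    and "\<And>\<omega>. \<omega> \<in> space M \<Longrightarrow> prob (X -` {X \<omega>} \<inter> space M) = 1 / k"
  shows "\<H>(X) = log b k"
proof -
  have "(\<integral>\<omega>. log b (prob (X -` {X \<omega>} \<inter> space M)) \<partial>M) = (\<integral>\<omega>. log b (1 / k) \<partial>M)"
    by (rule Bochner_Integration.integral_cong) (simp_all add: assms)
  then show ?thesis
    by (simp only: entropy_eq_expectation[OF X] lebesgue_integral_const log_recip) (simp add: prob_space)
qed

section \<open>The uniform source\<close>

text \<open>On a finite set with all subsets measurable it suffices to compare point masses. The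
  identification turns probabilities of the source into counts.\<close>

lemma iid_symbols_eq_uniform:
  assumes fin: "finite (carrier F)" and ne: "carrier F \<noteq> {}"
  shows "iid_symbols F n = uniform_count_measure ({..<n} \<rightarrow>\<^sub>E carrier F)"
proof (rule measure_eqI_finite)
  let ?U = "uniform_count_measure (carrier F)"
  interpret U: prob_space ?U
    by (rule prob_space_uniform_count_measure[OF fin ne])
  interpret product_sigma_finite "\<lambda>_. ?U"
    by (simp add: product_sigma_finite_def U.sigma_finite_measure_axioms)
  have "sets (iid_symbols F n) = sets (Pi\<^sub>M {..<n} (\<lambda>_. count_space (carrier F)))"
    unfolding iid_symbols_def by (intro sets_PiM_cong refl) (simp add: sets_uniform_count_measure_count_space)
  also have "\<dots> = Pow ({..<n} \<rightarrow>\<^sub>E carrier F)"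
    by (simp add: count_space_PiM_finite fin countable_finite)
  finally show "sets (iid_symbols F n) = Pow ({..<n} \<rightarrow>\<^sub>E carrier F)" .
  show "sets (uniform_count_measure ({..<n} \<rightarrow>\<^sub>E carrier F)) = Pow ({..<n} \<rightarrow>\<^sub>E carrier F)"
    by (rule sets_uniform_count_measure)
  show fin': "finite ({..<n} \<rightarrow>\<^sub>E carrier F)"
    by (simp add: finite_PiE fin)
  fix a assume a: "a \<in> {..<n} \<rightarrow>\<^sub>E carrier F"
  \<comment> \<open>A single vector is a box with singleton sides, to which the product formula
    applies.\<close>
  have "emeasure (iid_symbols F n) (Pi\<^sub>E {..<n} (\<lambda>i. {a i})) = (\<Prod>i<n. emeasure ?U {a i})"
    unfolding iid_symbols_def using a by (intro emeasure_PiM) (auto simp: sets_uniform_count_measure)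
  also have "\<dots> = (\<Prod>i<n. ennreal (1 / card (carrier F)))"
  proof (rule prod.cong[OF refl])
    fix i assume "i \<in> {..<n}"
    with a have "a i \<in> carrier F" by auto
    then show "emeasure ?U {a i} = ennreal (1 / card (carrier F))"
      by (simp add: emeasure_uniform_count_measure[OF fin])
  qed
  also have "\<dots> = ennreal ((1 / card (carrier F)) ^ n)"
    by (simp add: ennreal_power del: ennreal_1)
  also have "\<dots> = emeasure (uniform_count_measure ({..<n} \<rightarrow>\<^sub>E carrier F)) {a}"
    using a fin' by (simp add: emeasure_uniform_count_measure card_PiE power_divide)
  finally show "emeasure (iid_symbols F n) {a} = emeasure (uniform_count_measure ({..<n} \<rightarrow>\<^sub>E carrier F)) {a}"
    using PiE_singleton[of a "{..<n}"] a by (simp add: PiE_iff)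
qed

lemma pair_uniform_count_measure:
  assumes "finite A" "A \<noteq> {}" "finite B" "B \<noteq> {}"
  shows "uniform_count_measure A \<Otimes>\<^sub>M uniform_count_measure B = uniform_count_measure (A \<times> B)"
proof (rule measure_eqI_finite)
  interpret B: prob_space "uniform_count_measure B"
    by (rule prob_space_uniform_count_measure) fact+
  have "sets (uniform_count_measure A \<Otimes>\<^sub>M uniform_count_measure B) = sets (count_space A \<Otimes>\<^sub>M count_space B)"
    by (intro sets_pair_measure_cong sets_uniform_count_measure_count_space)
  then show "sets (uniform_count_measure A \<Otimes>\<^sub>M uniform_count_measure B) = Pow (A \<times> B)"
    using assms(1,3) by (simp only: pair_measure_count_space sets_count_space)
  fix a assume a: "a \<in> A \<times> B"
  then have "emeasure (uniform_count_measure A \<Otimes>\<^sub>M uniform_count_measure B) ({fst a} \<times> {snd a}) =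
      emeasure (uniform_count_measure A) {fst a} * emeasure (uniform_count_measure B) {snd a}"
    by (intro B.emeasure_pair_measure_Times) (auto simp: sets_uniform_count_measure)
  also have "\<dots> = ennreal (1 / card A) * ennreal (1 / card B)"
    using a assms by (auto simp: emeasure_uniform_count_measure)
  also have "\<dots> = ennreal (1 / card A * (1 / card B))"
    by (rule ennreal_mult[symmetric]) auto
  also have "\<dots> = emeasure (uniform_count_measure (A \<times> B)) {a}"
    using a assms by (simp add: emeasure_uniform_count_measure card_cartesian_product)
  finally show "emeasure (uniform_count_measure A \<Otimes>\<^sub>M uniform_count_measure B) {a} =
      emeasure (uniform_count_measure (A \<times> B)) {a}"
    by simp
qed (simp_all add: assms sets_uniform_count_measure)

definition sources :: "int ring \<Rightarrow> nat \<Rightarrow> nat \<Rightarrow> (vec \<times> vec) set" where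
  "sources F L LZ = ({..<L} \<rightarrow>\<^sub>E carrier F) \<times> ({..<LZ} \<rightarrow>\<^sub>E carrier F)"

lemma source_eq_uniform:
  assumes "finite (carrier F)" "carrier F \<noteq> {}"
  shows "source F L LZ = uniform_count_measure (sources F L LZ)"
  unfolding source_def sources_def iid_symbols_eq_uniform[OF assms]
  by (rule pair_uniform_count_measure) (use assms in \<open>auto simp: PiE_eq_empty_iff finite_PiE\<close>)

lemma finite_sources: "finite (carrier F) \<Longrightarrow> finite (sources F L LZ)"
  by (simp add: sources_def finite_PiE)

lemma sources_nonempty: "carrier F \<noteq> {} \<Longrightarrow> sources F L LZ \<noteq> {}"
  by (auto simp: sources_def PiE_eq_empty_iff)

lemma card_sources: "card (sources F L LZ) = card (carrier F) ^ (L + LZ)"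
  by (simp add: sources_def card_cartesian_product card_PiE power_add)

lemma space_source:
  assumes "finite (carrier F)" "carrier F \<noteq> {}"
  shows "space (source F L LZ) = sources F L LZ"
  by (simp add: source_eq_uniform[OF assms] space_uniform_count_measure)

lemma measure_source:
  assumes "finite (carrier F)" "carrier F \<noteq> {}" "A \<subseteq> sources F L LZ"
  shows "measure (source F L LZ) A = card A / card (carrier F) ^ (L + LZ)"
  using measure_uniform_count_measure[OF finite_sources[OF assms(1)] assms(3)]
  by (simp add: source_eq_uniform[OF assms(1,2)] card_sources)

text \<open>The sample space is finite with all subsets measurable, so signals carry no
  measurability conditions.\<close>

lemma simple_function_source:
  assumes "finite (carrier F)" "carrier F \<noteq> {}"
  shows "simple_function (source F L LZ) X"
  using finite_sources[OF assms(1), of L LZ]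
  by (auto simp: simple_function_def source_eq_uniform[OF assms] space_uniform_count_measure sets_uniform_count_measure)

lemma card_carrier_field:
  assumes "field (F :: int ring)" "finite (carrier F)"
  shows "card (carrier F) \<ge> 2"
proof -
  interpret field F by fact
  have "card {\<zero>\<^bsub>F\<^esub>, \<one>\<^bsub>F\<^esub>} \<le> card (carrier F)"
    using assms(2) by (intro card_mono) auto
  then show ?thesis by simp
qed

lemma information_space_source:
  assumes "finite (carrier F)" "card (carrier F) \<ge> 2"
  shows "information_space (source F L LZ) (card (carrier F))"
proof -
  have ne: "carrier F \<noteq> {}" using assms(2) by auto
  have "prob_space (source F L LZ)"
    unfolding source_eq_uniform[OF assms(1) ne]
    by (intro prob_space_uniform_count_measure finite_sources sources_nonempty assms(1) ne)
  then show ?thesis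
    using assms(2) by (simp add: information_space_def information_space_axioms_def)
qed

text \<open>Every fibre of \<open>fst\<close> is a copy of the noise space, so the values of the
  secret are equiprobable.\<close>

lemma entropy_secret:
  assumes "finite (carrier F)" "card (carrier F) \<ge> 2"
  shows "discrete_entropy (card (carrier F)) (source F L LZ) fst = L"
proof -
  let ?p = "card (carrier F)"
  have ne: "carrier F \<noteq> {}" using assms(2) by auto
  interpret information_space "source F L LZ" ?p
    by (rule information_space_source[OF assms])
  have "measure (source F L LZ) (fst -` {fst \<omega>} \<inter> space (source F L LZ)) = 1 / ?p ^ L"
    if "\<omega> \<in> space (source F L LZ)" for \<omega>
  proof -
    have "fst -` {fst \<omega>} \<inter> sources F L LZ = {fst \<omega>} \<times> ({..<LZ} \<rightarrow>\<^sub>E carrier F)"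
      using that by (auto simp: space_source[OF assms(1) ne] sources_def)
    then show ?thesis
      using assms(2) measure_source[OF assms(1) ne Int_lower2[of "fst -` {fst \<omega>}" "sources F L LZ"]]
      by (simp add: space_source[OF assms(1) ne] card_cartesian_product card_PiE power_add)
  qed
  then have "discrete_entropy ?p (source F L LZ) fst = log ?p (?p ^ L)"
    unfolding discrete_entropy_def
    by (intro entropy_equiprobable) (simp_all add: simple_function_source[OF assms(1) ne])
  then show ?thesis
    using assms(2) by (simp add: log_nat_power)
qed

text \<open>The total entropy, which is the budget in the dimension count behind security.\<close>

lemma entropy_source:
  assumes "finite (carrier F)" "card (carrier F) \<ge> 2"
  shows "discrete_entropy (card (carrier F)) (source F L LZ) id = L + LZ"
proof -
  let ?p = "card (carrier F)"
  have ne: "carrier F \<noteq> {}" using assms(2) by auto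
  interpret information_space "source F L LZ" ?p
    by (rule information_space_source[OF assms])
  have "measure (source F L LZ) (id -` {id \<omega>} \<inter> space (source F L LZ)) = 1 / ?p ^ (L + LZ)"
    if "\<omega> \<in> space (source F L LZ)" for \<omega>
  proof -
    have "id -` {id \<omega>} \<inter> sources F L LZ = {\<omega>}"
      using that by (auto simp: space_source[OF assms(1) ne])
    then show ?thesis
      using measure_source[OF assms(1) ne, of "{\<omega>}" L LZ] that
      by (simp add: space_source[OF assms(1) ne])
  qed
  then have "discrete_entropy ?p (source F L LZ) id = log ?p (?p ^ (L + LZ))"
    unfolding discrete_entropy_def
    by (intro entropy_equiprobable) (simp_all add: simple_function_source[OF assms(1) ne])
  then show ?thesis
    using assms(2) by (simp add: log_nat_power)
qed

section \<open>Paths and components\<close>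

text \<open>Reachability through \<open>adj_on\<close> replaces paths by arbitrary walks, which
  compose and reverse freely. Its reflexive transitive closure also relates vertices outside
  \<open>Q\<close> to themselves, so membership in \<open>Q\<close> is assumed separately where it
  matters.\<close>

definition adj_on :: "'v set \<Rightarrow> 'v set set \<Rightarrow> 'v rel" where
  "adj_on Q E = {(u, w). u \<in> Q \<and> w \<in> Q \<and> {u, w} \<in> E}"

lemma sym_adj_on: "sym (adj_on Q E)"
  by (auto simp: adj_on_def sym_def insert_commute)

lemma sym_rtrancl_adj_on: "(u, w) \<in> (adj_on Q E)\<^sup>* \<Longrightarrow> (w, u) \<in> (adj_on Q E)\<^sup>*"
  using sym_rtrancl[OF sym_adj_on] by (rule symD)

lemma path_edges_Nil: "path_edges [] = []"
  by (simp add: path_edges_def)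

lemma path_edges_Cons: "path_edges (a # vs) = (if vs = [] then [] else {a, hd vs} # path_edges vs)"
  by (cases vs) (auto simp: path_edges_def)

lemma path_edges_subset: "e \<in> set (path_edges vs) \<Longrightarrow> e \<subseteq> set vs"
  by (induction vs) (auto simp: path_edges_Cons path_edges_Nil split: if_splits)

text \<open>The first edge contains the first vertex, which no later edge contains.\<close>

lemma distinct_path_edges: "distinct vs \<Longrightarrow> distinct (path_edges vs)"
proof (induction vs)
  case (Cons a vs)
  then show ?case
    using path_edges_subset[of "{a, hd vs}" vs] by (auto simp: path_edges_Cons)
qed (simp add: path_edges_Nil)

lemma path_edges_append: "set (path_edges ys) \<subseteq> set (path_edges (xs @ ys))"
  by (induction xs) (auto simp: path_edges_Cons path_edges_Nil)

lemma rtrancl_path_hd: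
  assumes "set (path_edges vs) \<subseteq> E" "set vs \<subseteq> Q" "u \<in> set vs"
  shows "(hd vs, u) \<in> (adj_on Q E)\<^sup>*"
  using assms
proof (induction vs)
  case (Cons a vs)
  show ?case
  proof (cases "u = a")
    case False
    with Cons.prems have ne: "vs \<noteq> []" and u: "u \<in> set vs"
      by auto
    with Cons.prems have "(a, hd vs) \<in> adj_on Q E"
      by (auto simp: path_edges_Cons adj_on_def)
    moreover have "(hd vs, u) \<in> (adj_on Q E)\<^sup>*"
      using Cons ne u by (auto simp: path_edges_Cons)
    ultimately show ?thesis
      by (simp add: converse_rtrancl_into_rtrancl)
  qed simp
qed simp

lemma rtrancl_is_path:
  assumes "is_path E vs" "set vs \<subseteq> Q" "u \<in> set vs" "w \<in> set vs"
  shows "(u, w) \<in> (adj_on Q E)\<^sup>*"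
proof -
  have "(hd vs, v) \<in> (adj_on Q E)\<^sup>*" if "v \<in> set vs" for v
    using assms(1,2) that by (intro rtrancl_path_hd) (auto simp: is_path_def)
  then show ?thesis
    using assms(3,4) by (meson rtrancl_trans sym_rtrancl_adj_on)
qed

lemma ex_is_path:
  assumes "(u, w) \<in> (adj_on Q E)\<^sup>*" "w \<in> Q"
  shows "\<exists>vs. is_path E vs \<and> set vs \<subseteq> Q \<and> hd vs = u \<and> last vs = w"
proof -
  \<comment> \<open>Distinct vertices are stronger than the distinct edges of
    \<open>is_path\<close>, and are easier to maintain in the induction: a vertex that occurs again
    is handled by keeping only the part of the list from it onwards.\<close>
  have "\<exists>vs. vs \<noteq> [] \<and> set (path_edges vs) \<subseteq> E \<and> distinct vs \<and> set vs \<subseteq> Q \<and> hd vs = u \<and> last vs = w"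
    using assms(1)
  proof (induction rule: converse_rtrancl_induct)
    case base
    show ?case
      by (rule exI[of _ "[w]"]) (simp add: path_edges_def assms(2))
  next
    case (step u v)
    then obtain vs where vs: "vs \<noteq> []" "set (path_edges vs) \<subseteq> E" "distinct vs" "set vs \<subseteq> Q"
        "hd vs = v" "last vs = w"
      by blast
    show ?case
    proof (cases "u \<in> set vs")
      case True
      then obtain xs ys where "vs = xs @ u # ys"
        by (meson split_list)
      then show ?thesis
        using vs path_edges_append[of "u # ys" xs] by (intro exI[of _ "u # ys"]) auto
    next
      case False
      then show ?thesis
        using vs step(1) by (intro exI[of _ "u # vs"]) (auto simp: path_edges_Cons adj_on_def)
    qed
  qed
  then show ?thesis
    unfolding is_path_def using distinct_path_edges by blast
qed

text \<open>The connecting paths in the definition are not confined to \<open>Q\<close>, hence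
  \<open>UNIV\<close>.\<close>

lemma qualified_connected_iff:
  "qualified_connected I f Q \<longleftrightarrow>
    (\<forall>u\<in>Q. \<forall>w\<in>Q. (u, w) \<in> (adj_on UNIV (qualified_edges I f))\<^sup>*)"
  unfolding qualified_connected_def
proof (intro ball_cong refl iffI)
  fix u w
  assume "\<exists>vs. is_path (qualified_edges I f) vs \<and> hd vs = u \<and> last vs = w"
  then obtain vs where "is_path (qualified_edges I f) vs" "hd vs = u" "last vs = w"
    by blast
  then show "(u, w) \<in> (adj_on UNIV (qualified_edges I f))\<^sup>*"
    using rtrancl_is_path[of "qualified_edges I f" vs UNIV u w]
    by (auto simp: is_path_def)
next
  fix u w
  assume "(u, w) \<in> (adj_on UNIV (qualified_edges I f))\<^sup>*"
  then show "\<exists>vs. is_path (qualified_edges I f) vs \<and> hd vs = u \<and> last vs = w"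
    using ex_is_path[of u w UNIV] by blast
qed

text \<open>A connected set containing \<open>v\<close> lies in the reachability class of
  \<open>v\<close>, so the class is maximal. The achievability part works with these
  classes.\<close>

lemma qualified_component_Image:
  "qualified_component I f ((adj_on UNIV (qualified_edges I f))\<^sup>* `` {v})"
  unfolding qualified_component_def qualified_connected_iff
proof (intro conjI ballI allI impI notI)
  let ?r = "(adj_on UNIV (qualified_edges I f))\<^sup>*"
  show "(u, w) \<in> ?r" if "u \<in> ?r `` {v}" "w \<in> ?r `` {v}" for u w
    using that sym_rtrancl_adj_on by (metis Image_singleton_iff rtrancl_trans)
  fix Q assume Q: "?r `` {v} \<subset> Q" and conn: "\<forall>u\<in>Q. \<forall>w\<in>Q. (u, w) \<in> ?r"
  have "v \<in> Q"
    using Q by auto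
  with conn have "Q \<subseteq> ?r `` {v}"
    by auto
  with Q show False
    by auto
qed

section \<open>Entropy inequalities for schemes\<close>

text \<open>\<open>None\<close> indexes the secret and \<open>Some v\<close> the signal of
  \<open>v\<close>. Restricting to \<open>A\<close> gives all subfamilies the same type, so joint
  entropy becomes a function of the set \<open>A\<close>.\<close>

definition joint :: "('v \<Rightarrow> vec \<times> vec \<Rightarrow> vec) \<Rightarrow> 'v option set \<Rightarrow> vec \<times> vec \<Rightarrow> 'v option \<Rightarrow> vec" where
  "joint \<sigma> A \<omega> = restrict (case_option (fst \<omega>) (\<lambda>v. \<sigma> v \<omega>)) A"

lemma joint_eq_iff:
  "joint \<sigma> A \<omega> = joint \<sigma> A \<omega>' \<longleftrightarrow>
    (None \<in> A \<longrightarrow> fst \<omega> = fst \<omega>') \<and> (\<forall>v. Some v \<in> A \<longrightarrow> \<sigma> v \<omega> = \<sigma> v \<omega>')"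
proof -
  have "joint \<sigma> A \<omega> = joint \<sigma> A \<omega>' \<longleftrightarrow>
    (\<forall>i\<in>A. case_option (fst \<omega>) (\<lambda>v. \<sigma> v \<omega>) i = case_option (fst \<omega>') (\<lambda>v. \<sigma> v \<omega>') i)"
    unfolding joint_def fun_eq_iff restrict_def by (intro iffI ballI allI) (auto split: if_splits)
  then show ?thesis
    by (auto split: option.splits)
qed

text \<open>The converse sees a scheme only through this polymatroid on the secret and the signals.
  Correctness and security are stated with joint entropies in place of conditional ones.\<close>

locale cds_entropy =
  fixes I :: "('x \<times> 'y) set" and f :: "'x \<times> 'y \<Rightarrow> bool"
    and l :: real and N :: "'x + 'y \<Rightarrow> real"
    and h :: "('x + 'y) option set \<Rightarrow> real"
  assumes h_mono: "A \<subseteq> B \<Longrightarrow> h A \<le> h B"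
    and h_submodular: "h (A \<union> B) + h (A \<inter> B) \<le> h A + h B"
    and h_empty: "h {} = 0"
    and h_secret: "h {None} = l"
    and h_length: "h {Some v} \<le> N v"
    and correct: "(x, y) \<in> I \<Longrightarrow> f (x, y) \<Longrightarrow>
      h {None, Some (Inl x), Some (Inr y)} = h {Some (Inl x), Some (Inr y)}"
    and secure: "(x, y) \<in> I \<Longrightarrow> \<not> f (x, y) \<Longrightarrow>
      h {None, Some (Inl x), Some (Inr y)} = l + h {Some (Inl x), Some (Inr y)}"

lemma discrete_cond_entropy_chain:
  assumes "finite (carrier F)" "card (carrier F) \<ge> 2"
  shows "discrete_entropy (card (carrier F)) (source F L LZ) (\<lambda>\<omega>. (U \<omega>, W \<omega>)) =
    discrete_entropy (card (carrier F)) (source F L LZ) W +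
    discrete_cond_entropy (card (carrier F)) (source F L LZ) U W"
proof -
  have ne: "carrier F \<noteq> {}" using assms(2) by auto
  interpret information_space "source F L LZ" "card (carrier F)"
    by (rule information_space_source[OF assms])
  note sf = simple_function_source[OF assms(1) ne]
  \<comment> \<open>The pair is swapped because \<open>entropy_chain_rule\<close> lists the
    conditioning variable first.\<close>
  have "discrete_entropy (card (carrier F)) (source F L LZ) (\<lambda>\<omega>. (U \<omega>, W \<omega>)) =
      discrete_entropy (card (carrier F)) (source F L LZ) (\<lambda>\<omega>. (W \<omega>, U \<omega>))"
    unfolding discrete_entropy_def by (rule entropy_cong_fibres[OF sf sf]) auto
  also have "\<dots> = discrete_entropy (card (carrier F)) (source F L LZ) W +
      discrete_cond_entropy (card (carrier F)) (source F L LZ) U W"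
    unfolding discrete_entropy_def discrete_cond_entropy_def by (intro entropy_chain_rule sf)
  finally show ?thesis .
qed

lemma cds_entropy_scheme:
  fixes I :: "('x::finite \<times> 'y::finite) set"
  assumes sch: "cds_scheme I f F L LZ N \<sigma>"
  shows "cds_entropy I f L (\<lambda>v. N v)
    (\<lambda>A. discrete_entropy (card (carrier F)) (source F L LZ) (joint \<sigma> A))"
proof -
  let ?p = "card (carrier F)" and ?M = "source F L LZ"
  define h where "h A = discrete_entropy ?p ?M (joint \<sigma> A)" for A
  have fin: "finite (carrier F)" and p: "?p \<ge> 2"
    using sch card_carrier_field unfolding cds_scheme_def by blast+
  have ne: "carrier F \<noteq> {}" using p by auto
  interpret information_space ?M ?p
    by (rule information_space_source[OF fin p])
  note sf = simple_function_source[OF fin ne, of L LZ]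
  note H_mono = entropy_mono[OF sf sf, folded discrete_entropy_def]
  note H_cong = entropy_cong_fibres[OF sf sf, folded discrete_entropy_def]
  note H_sub = entropy_submodular[OF sf sf sf, folded discrete_entropy_def]
  have h_eq: "h {Some (Inl x), Some (Inr y)} =
      discrete_entropy ?p ?M (\<lambda>\<omega>. (\<sigma> (Inl x) \<omega>, \<sigma> (Inr y) \<omega>))"
    "h {None, Some (Inl x), Some (Inr y)} =
      discrete_entropy ?p ?M (\<lambda>\<omega>. (fst \<omega>, (\<sigma> (Inl x) \<omega>, \<sigma> (Inr y) \<omega>)))" for x y
    unfolding h_def by (rule H_cong; auto simp: joint_eq_iff)+
  note h_eq' = h_eq(1) trans[OF h_eq(2) discrete_cond_entropy_chain[OF fin p]]
  have "cds_entropy I f L (\<lambda>v. N v) h"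
  proof
    show "h A \<le> h B" if "A \<subseteq> B" for A B
      unfolding h_def by (rule H_mono) (use that in \<open>auto simp: joint_eq_iff\<close>)
    show "h (A \<union> B) + h (A \<inter> B) \<le> h A + h B" for A B
    proof -
      let ?H = "discrete_entropy ?p ?M"
      \<comment> \<open>The variables of \<open>A \<inter> B\<close> are determined by either
        family. Adjoining them brings the claim into the form of \<open>entropy_submodular\<close>,
        with the intersection as conditioning variable.\<close>
      have "h (A \<union> B) \<le> ?H (\<lambda>\<omega>. (joint \<sigma> A \<omega>, joint \<sigma> B \<omega>, joint \<sigma> (A \<inter> B) \<omega>))"
        unfolding h_def by (rule H_mono) (auto simp: joint_eq_iff)
      moreover have "?H (\<lambda>\<omega>. (joint \<sigma> A \<omega>, joint \<sigma> (A \<inter> B) \<omega>)) \<le> h A"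
        unfolding h_def by (rule H_mono) (auto simp: joint_eq_iff)
      moreover have "?H (\<lambda>\<omega>. (joint \<sigma> B \<omega>, joint \<sigma> (A \<inter> B) \<omega>)) \<le> h B"
        unfolding h_def by (rule H_mono) (auto simp: joint_eq_iff)
      ultimately show ?thesis
        using H_sub[of "joint \<sigma> A" "joint \<sigma> B" "joint \<sigma> (A \<inter> B)"] by (simp add: h_def)
    qed
    have "joint \<sigma> {} = (\<lambda>_ _. undefined)"
      by (auto simp: joint_def restrict_def)
    then show "h {} = 0"
      unfolding h_def discrete_entropy_def by (simp only: entropy_const)
    have "h {None} = discrete_entropy ?p ?M fst"
      unfolding h_def by (rule H_cong) (auto simp: joint_eq_iff)
    then show "h {None} = L"
      by (simp add: entropy_secret[OF fin p])
    show "h {Some v} \<le> N v" for v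
    proof -
      have "h {Some v} \<le> discrete_entropy ?p ?M (\<sigma> v)"
        unfolding h_def by (rule H_mono) (auto simp: joint_eq_iff)
      also have "\<dots> \<le> log ?p (card ({..<N v} \<rightarrow>\<^sub>E carrier F))"
        unfolding discrete_entropy_def using sch
        by (intro entropy_le_log_card sf) (auto simp: cds_scheme_def finite_PiE fin)
      also have "\<dots> = N v"
        using p by (simp add: card_PiE log_nat_power)
      finally show ?thesis .
    qed
    show "h {None, Some (Inl x), Some (Inr y)} = h {Some (Inl x), Some (Inr y)}"
      if "(x, y) \<in> I" "f (x, y)" for x y
    proof -
      have "discrete_cond_entropy ?p ?M fst (\<lambda>\<omega>. (\<sigma> (Inl x) \<omega>, \<sigma> (Inr y) \<omega>)) = 0"
        using sch that unfolding cds_scheme_def Let_def by blast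
      then show ?thesis by (simp add: h_eq')
    qed
    show "h {None, Some (Inl x), Some (Inr y)} = L + h {Some (Inl x), Some (Inr y)}"
      if "(x, y) \<in> I" "\<not> f (x, y)" for x y
    proof -
      have "discrete_cond_entropy ?p ?M fst (\<lambda>\<omega>. (\<sigma> (Inl x) \<omega>, \<sigma> (Inr y) \<omega>)) = discrete_entropy ?p ?M fst"
        using sch that unfolding cds_scheme_def Let_def by blast
      then show ?thesis by (simp add: h_eq' entropy_secret[OF fin p])
    qed
  qed
  then show ?thesis
    by (simp only: h_def[abs_def])
qed

section \<open>Conditional entropies along qualified and unqualified edges\<close>

context cds_entropy
begin

text \<open>This is \<open>H(u | w, D)\<close>. The two cases of interest are \<open>D = {}\<close>
  and \<open>D = {None}\<close>, that is, without and with the secret.\<close>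

definition cond :: "'x + 'y \<Rightarrow> 'x + 'y \<Rightarrow> ('x + 'y) option set \<Rightarrow> real" where
  "cond u w D = h (insert (Some u) (insert (Some w) D)) - h (insert (Some w) D)"

lemma cond_refl: "cond u u D = 0"
  by (simp add: cond_def)

text \<open>Submodularity makes \<open>cond\<close> a directed distance, so bounds on single edges
  add up along walks.\<close>

lemma cond_triangle: "cond u w D \<le> cond u v D + cond v w D"
proof -
  let ?A = "insert (Some u) (insert (Some v) D)" and ?B = "insert (Some v) (insert (Some w) D)"
  have "h (?A \<union> ?B) + h (?A \<inter> ?B) \<le> h ?A + h ?B"
    by (rule h_submodular)
  moreover have "h (insert (Some u) (insert (Some w) D)) \<le> h (?A \<union> ?B)"
    by (rule h_mono) auto
  moreover have "h (insert (Some v) D) \<le> h (?A \<inter> ?B)"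
    by (rule h_mono) auto
  ultimately show ?thesis
    unfolding cond_def by linarith
qed

lemma qualified_edge:
  assumes "{u, w} \<in> qualified_edges I f"
  shows "h {None, Some u, Some w} = h {Some u, Some w}"
  using assms correct
  by (auto simp: qualified_edges_def graph_edges_def doubleton_eq_iff insert_commute)

lemma unqualified_edge:
  assumes "{u, w} \<in> unqualified_edges I f"
  shows "h {None, Some u, Some w} = l + h {Some u, Some w}"
  using assms secure
  by (auto simp: unqualified_edges_def graph_edges_def doubleton_eq_iff insert_commute)

text \<open>Non-degeneracy puts every vertex on an unqualified edge, and security of that edge makes
  the single signal independent of the secret.\<close>

lemma entropy_with_secret:
  assumes "non_degenerate I f"
  shows "h {None, Some u} = l + h {Some u}"
proof (rule antisym)
  show "h {None, Some u} \<le> l + h {Some u}"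
    using h_submodular[of "{None}" "{Some u}"] by (simp add: h_secret h_empty insert_commute)
  obtain e where "e \<in> unqualified_edges I f" "u \<in> e"
    using assms unfolding non_degenerate_def by blast
  then obtain x y where xy: "(x, y) \<in> I" "\<not> f (x, y)" "u \<in> {Inl x, Inr y}"
    by (auto simp: unqualified_edges_def graph_edges_def)
  obtain w where w: "{u, w} = {Inl x, Inr y}"
    using xy(3) by (auto simp: insert_commute)
  then have w: "{u, w} \<in> unqualified_edges I f"
    using xy(1,2) by (auto simp: unqualified_edges_def graph_edges_def)
  \<comment> \<open>Adjoining \<open>w\<close> to the secret and \<open>u\<close> adds at most
    \<open>H(u, w) - H(u)\<close>, while security makes the total
    \<open>l + H(u, w)\<close>.\<close>
  have "h ({None, Some u} \<union> {Some u, Some w}) + h ({None, Some u} \<inter> {Some u, Some w})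
      \<le> h {None, Some u} + h {Some u, Some w}"
    by (rule h_submodular)
  moreover have "{None, Some u} \<union> {Some u, Some w} = {None, Some u, Some w}"
    by auto
  moreover have "h {Some u} \<le> h ({None, Some u} \<inter> {Some u, Some w})"
    by (rule h_mono) auto
  ultimately show "l + h {Some u} \<le> h {None, Some u}"
    using unqualified_edge[OF w] by simp
qed

text \<open>The signal of \<open>w\<close> alone is independent of the secret, yet together with
  that of \<open>u\<close> it reveals it; so \<open>u\<close> must contribute at least
  \<open>l\<close>.\<close>

lemma qualified_le_cond:
  assumes nd: "non_degenerate I f" and e: "{u, w} \<in> qualified_edges I f"
  shows "l \<le> cond u w {}"
proof -
  have "h {None, Some w} \<le> h {None, Some u, Some w}"
    by (rule h_mono) auto
  then show ?thesis
    using entropy_with_secret[OF nd, of w] qualified_edge[OF e] by (simp add: cond_def)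
qed

lemma cond_le_length: "cond u w {} \<le> N u"
  using h_submodular[of "{Some u}" "{Some w}"] h_mono[of "{}" "{Some u} \<inter> {Some w}"] h_length[of u]
  by (simp add: cond_def h_empty insert_commute)

lemma qualified_le_length:
  assumes "non_degenerate I f" and "{u, w} \<in> qualified_edges I f"
  shows "l \<le> N u"
  using qualified_le_cond[OF assms] cond_le_length[of u w] by linarith

text \<open>Of \<open>H(u | w)\<close>, which is at most \<open>N u\<close>, the amount
  \<open>l\<close> is taken up by the secret; only the excess length remains.\<close>

lemma cond_secret_qualified:
  assumes nd: "non_degenerate I f" and e: "{u, w} \<in> qualified_edges I f"
  shows "cond u w {None} \<le> N u - l"
  using cond_le_length[of u w] entropy_with_secret[OF nd, of w] qualified_edge[OF e]
  by (simp add: cond_def insert_commute)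

text \<open>Adding the secret raises both entropies in the difference by \<open>l\<close>.\<close>

lemma cond_secret_unqualified:
  assumes nd: "non_degenerate I f" and e: "{u, w} \<in> unqualified_edges I f"
  shows "cond u w {None} = cond u w {}"
  using entropy_with_secret[OF nd, of w] unqualified_edge[OF e]
  by (simp add: cond_def insert_commute)

lemma cond_secret_qualified_rtrancl:
  fixes d :: real
  assumes nd: "non_degenerate I f" and N: "\<And>v. N v \<le> l + d"
    and "(u, w) \<in> (adj_on UNIV (qualified_edges I f)) ^^ k"
  shows "cond u w {None} \<le> k * d"
  using assms(3)
proof (induction k arbitrary: w)
  case (Suc k)
  then obtain v where v: "cond u v {None} \<le> k * d" "{v, w} \<in> qualified_edges I f"
    by (auto simp: adj_on_def)
  have "cond u w {None} \<le> cond u v {None} + cond v w {None}"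
    by (rule cond_triangle)
  also have "\<dots> \<le> k * d + d"
    using v cond_secret_qualified[OF nd v(2)] N[of v] by (intro add_mono) auto
  finally show ?case by (simp add: algebra_simps)
qed (simp add: cond_refl)

end

text \<open>
  The constant has to be independent of the scheme, since the capacity is a limit over schemes.
\<close>

lemma ex_cond_secret_bound:
  assumes nd: "non_degenerate I f"
    and "(u, w) \<in> (adj_on UNIV (qualified_edges I f))\<^sup>*"
  shows "\<exists>k :: nat. \<forall>l N h (d :: real). cds_entropy I f l N h \<longrightarrow> (\<forall>v. N v \<le> l + d) \<longrightarrow>
    cds_entropy.cond h u w {None} \<le> k * d"
proof -
  obtain k where k: "(u, w) \<in> (adj_on UNIV (qualified_edges I f)) ^^ k"
    using assms(2) rtrancl_imp_relpow by blast
  have "cds_entropy.cond h u w {None} \<le> k * d"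
    if h: "cds_entropy I f l N h" and N: "\<forall>v. N v \<le> l + d" for l N h and d :: real
    by (rule cds_entropy.cond_secret_qualified_rtrancl[OF h nd _ k]) (use N in blast)
  then show ?thesis by blast
qed

text \<open>The ends of each unqualified edge in \<open>Q\<close> are also joined by a qualified
  walk, which bounds their \<open>cond\<close> given the secret. The unqualified edge then lets the
  secret be dropped, and the triangle inequality sums over the edges.\<close>

lemma ex_cond_bound:
  assumes nd: "non_degenerate I f"
    and conn: "\<And>u w. u \<in> Q \<Longrightarrow> w \<in> Q \<Longrightarrow> (u, w) \<in> (adj_on UNIV (qualified_edges I f))\<^sup>*"
    and "(u, w) \<in> (adj_on Q (unqualified_edges I f))\<^sup>*"
  shows "\<exists>k :: nat. \<forall>l N h (d :: real). cds_entropy I f l N h \<longrightarrow> (\<forall>v. N v \<le> l + d) \<longrightarrow>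
    cds_entropy.cond h u w {} \<le> k * d"
  using assms(3)
proof (induction rule: rtrancl_induct)
  case base
  show ?case
    by (rule exI[of _ 0]) (auto simp: cds_entropy.cond_refl)
next
  case (step v w)
  from step.IH obtain k :: nat where k: "\<And>l N h (d :: real). cds_entropy I f l N h \<Longrightarrow> \<forall>v. N v \<le> l + d \<Longrightarrow>
      cds_entropy.cond h u v {} \<le> k * d"
    by blast
  from step(2) have e: "{v, w} \<in> unqualified_edges I f" and Q: "v \<in> Q" "w \<in> Q"
    by (auto simp: adj_on_def)
  obtain m :: nat where m: "\<And>l N h (d :: real). cds_entropy I f l N h \<Longrightarrow> \<forall>v. N v \<le> l + d \<Longrightarrow>
      cds_entropy.cond h v w {None} \<le> m * d"
    using ex_cond_secret_bound[OF nd conn[OF Q]] by blast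
  have "cds_entropy.cond h u w {} \<le> (k + m) * d"
    if h: "cds_entropy I f l N h" and N: "\<forall>v. N v \<le> l + d" for l N h and d :: real
    using k[OF h N] m[OF h N] cds_entropy.cond_triangle[OF h, of u w "{}" v]
      cds_entropy.cond_secret_unqualified[OF h nd e]
    by (simp add: algebra_simps)
  then show ?case
    by (intro exI[of _ "k + m"]) simp
qed

section \<open>Upper bounds on the capacity\<close>

text \<open>The lower bound \<open>l\<close> on \<open>H(u | w)\<close> from the qualified edge
  meets the upper bound from the unqualified path between the same vertices.\<close>

lemma internal_edge_excess:
  assumes nd: "non_degenerate I f"
    and Q: "qualified_component I f Q" "is_path (unqualified_edges I f) vs" "set vs \<subseteq> Q"
    and e: "internal_qualified_edge I f vs e"
  shows "\<exists>k :: nat. \<forall>l N h (d :: real). cds_entropy I f l N h \<longrightarrow> (\<forall>v. N v \<le> l + d) \<longrightarrow> l \<le> k * d"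
proof -
  from e obtain u w where uw: "{u, w} \<in> qualified_edges I f" "u \<in> set vs" "w \<in> set vs"
    by (auto simp: internal_qualified_edge_def qualified_edges_def graph_edges_def)
  have "\<exists>k :: nat. \<forall>l N h (d :: real). cds_entropy I f l N h \<longrightarrow> (\<forall>v. N v \<le> l + d) \<longrightarrow>
      cds_entropy.cond h u w {} \<le> k * d"
  proof (rule ex_cond_bound[OF nd])
    show "(u, w) \<in> (adj_on UNIV (qualified_edges I f))\<^sup>*" if "u \<in> Q" "w \<in> Q" for u w
      using Q(1) that unfolding qualified_component_def qualified_connected_iff by blast
    show "(u, w) \<in> (adj_on Q (unqualified_edges I f))\<^sup>*"
      by (rule rtrancl_is_path[OF Q(2,3) uw(2,3)])
  qed
  then obtain k :: nat where k: "\<And>l N h (d :: real). cds_entropy I f l N h \<Longrightarrow> \<forall>v. N v \<le> l + d \<Longrightarrow>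
      cds_entropy.cond h u w {} \<le> k * d"
    by blast
  have "l \<le> k * d" if h: "cds_entropy I f l N h" and N: "\<forall>v. N v \<le> l + d" for l N h and d :: real
    using k[OF h N] cds_entropy.qualified_le_cond[OF h nd uw(1)] by linarith
  then show ?thesis
    by blast
qed

text \<open>The bound survives the closure because the tuples with some component at most
  \<open>c\<close> form a finite union of closed half-spaces. The component may vary with the
  scheme, and the symmetric tuple makes it irrelevant in the end.\<close>

lemma cds_capacity_le:
  fixes I :: "('x::finite \<times> 'y::finite) set"
  assumes "\<And>t. t \<in> achievable_tuples I f \<Longrightarrow> \<exists>v. t $ v \<le> c"
  shows "cds_capacity I f \<le> ereal (c / 2)"
proof -
  have "closed {t :: real ^ ('x + 'y). \<exists>v. t $ v \<le> c}"
    unfolding Collect_ex_eq by (intro closed_UN) (simp_all add: closed_halfspace_component_le_cart)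
  then have region: "capacity_region I f \<subseteq> {t. \<exists>v. t $ v \<le> c}"
    unfolding capacity_region_def using assms by (intro closure_minimal) auto
  show ?thesis
    unfolding cds_capacity_def
  proof (rule SUP_least)
    fix R assume "R \<in> achievable_rates I f"
    then obtain L N :: nat where "R = real L / (2 * real N)"
        "(\<chi> v. real L / real N) \<in> capacity_region I f"
      by (auto simp: achievable_rates_def)
    with region show "ereal R \<le> ereal (c / 2)"
      by (auto simp: field_simps)
  qed
qed

text \<open>An end of a qualified edge needs a signal at least as long as the secret.\<close>

lemma capacity_le_half:
  fixes I :: "('x::finite \<times> 'y::finite) set"
  assumes nd: "non_degenerate I f" and ne: "qualified_edges I f \<noteq> {}"
  shows "cds_capacity I f \<le> ereal (1 / 2)"
proof (rule cds_capacity_le)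
  fix t assume "t \<in> achievable_tuples I f"
  then obtain L N F LZ \<sigma> where t: "t = (\<chi> v. real L / real (N v))"
      and sch: "cds_scheme I f F L LZ N \<sigma>"
    by (auto simp: achievable_tuples_def)
  obtain u w where "{u, w} \<in> qualified_edges I f"
    using ne by (auto simp: qualified_edges_def graph_edges_def)
  then have "real L \<le> real (N u)"
    by (rule cds_entropy.qualified_le_length[OF cds_entropy_scheme[OF sch] nd])
  then show "\<exists>v. t $ v \<le> 1"
    by (intro exI[of _ u]) (auto simp: t divide_le_eq_1)
qed

lemma capacity_less_half:
  fixes I :: "('x::finite \<times> 'y::finite) set"
  assumes nd: "non_degenerate I f"
    and Q: "qualified_component I f Q" "is_path (unqualified_edges I f) vs" "set vs \<subseteq> Q"
    and e: "internal_qualified_edge I f vs e"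
  shows "cds_capacity I f < ereal (1 / 2)"
proof -
  obtain k :: nat where k: "\<And>l N h (d :: real). cds_entropy I f l N h \<Longrightarrow> \<forall>v. N v \<le> l + d \<Longrightarrow> l \<le> k * d"
    using internal_edge_excess[OF assms] by blast
  \<comment> \<open>If all ratios exceeded \<open>(k + 1) / (k + 2)\<close>, every length would be
    at most \<open>L + d\<close> with \<open>d = L / (k + 1)\<close>, and
    \<open>L \<le> k * d\<close> would fail.\<close>
  have "cds_capacity I f \<le> ereal ((k + 1) / (k + 2) / 2)"
  proof (rule cds_capacity_le)
    fix t assume "t \<in> achievable_tuples I f"
    then obtain L N F LZ \<sigma> where t: "t = (\<chi> v. real L / real (N v))"
        and sch: "cds_scheme I f F L LZ N \<sigma>"
      by (auto simp: achievable_tuples_def)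
    have L: "L \<ge> 1" and N: "N v \<ge> 1" for v
      using sch by (auto simp: cds_scheme_def)
    show "\<exists>v. t $ v \<le> (k + 1) / (k + 2)"
    proof (rule ccontr)
      assume "\<nexists>v. t $ v \<le> (k + 1) / (k + 2)"
      then have less: "(k + 1) / (k + 2) < real L / real (N v)" for v
        by (auto simp: t not_le)
      have "real (N v) \<le> real L + real L / (k + 1)" for v
        using less[of v] N[of v] by (simp add: field_simps)
      then have "real L \<le> k * (real L / (k + 1))"
        using k[OF cds_entropy_scheme[OF sch]] by blast
      then show False
        using L by (simp add: field_simps)
    qed
  qed
  also have "\<dots> < ereal (1 / 2)"
    by (simp add: field_simps)
  finally show ?thesis .
qed

section \<open>The linear scheme\<close>

lemma discrete_entropy_le:
  assumes F: "finite (carrier F)" "card (carrier F) \<ge> 2"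
    and A: "X ` sources F L LZ \<subseteq> A" "finite A" "card A \<le> card (carrier F) ^ k"
  shows "discrete_entropy (card (carrier F)) (source F L LZ) X \<le> k"
proof -
  let ?p = "card (carrier F)"
  have ne: "carrier F \<noteq> {}" using F(2) by auto
  interpret information_space "source F L LZ" ?p
    by (rule information_space_source[OF F])
  have "A \<noteq> {}"
    using A(1) sources_nonempty[OF ne, of L LZ] by auto
  then have pos: "0 < real (card A)"
    using A(2) by (simp add: card_gt_0_iff)
  have "discrete_entropy ?p (source F L LZ) X \<le> log ?p (card A)"
    unfolding discrete_entropy_def using A(1,2)
    by (intro entropy_le_log_card simple_function_source[OF F(1) ne]) (simp_all add: space_source[OF F(1) ne])
  also have "\<dots> \<le> log ?p (real (?p ^ k))"
    using pos A(3) F(2) by (subst log_le_cancel_iff) (auto simp del: of_nat_power)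
  also have "\<dots> = k"
    using F(2) by (simp add: log_nat_power)
  finally show ?thesis .
qed

lemma discrete_cond_entropy_eq_0:
  assumes F: "finite (carrier F)" "card (carrier F) \<ge> 2"
    and "\<And>\<omega> \<omega>'. \<omega> \<in> sources F L LZ \<Longrightarrow> \<omega>' \<in> sources F L LZ \<Longrightarrow> W \<omega> = W \<omega>' \<Longrightarrow> U \<omega> = U \<omega>'"
  shows "discrete_cond_entropy (card (carrier F)) (source F L LZ) U W = 0"
proof -
  have ne: "carrier F \<noteq> {}" using F(2) by auto
  interpret information_space "source F L LZ" "card (carrier F)"
    by (rule information_space_source[OF F])
  have "discrete_entropy (card (carrier F)) (source F L LZ) (\<lambda>\<omega>. (U \<omega>, W \<omega>)) =
      discrete_entropy (card (carrier F)) (source F L LZ) W"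
    unfolding discrete_entropy_def
  proof (rule entropy_cong_fibres[OF simple_function_source[OF F(1) ne] simple_function_source[OF F(1) ne]])
    fix \<omega> \<omega>' assume "\<omega> \<in> space (source F L LZ)" "\<omega>' \<in> space (source F L LZ)"
    then show "(U \<omega>, W \<omega>) = (U \<omega>', W \<omega>') \<longleftrightarrow> W \<omega> = W \<omega>'"
      using assms(3)[of \<omega> \<omega>'] by (auto simp: space_source[OF F(1) ne])
  qed
  then show ?thesis
    using discrete_cond_entropy_chain[OF F, of L LZ U W] by simp
qed

text \<open>
  A dimension count replaces the computation of joint distributions: \<open>R\<close> completes the secret and
  \<open>W\<close> to the whole sample, which leaves \<open>W\<close> no room to be correlated with the secret.
\<close>

lemma discrete_cond_entropy_secret_eq:
  assumes F: "finite (carrier F)" "card (carrier F) \<ge> 2"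
    and W: "W ` sources F L LZ \<subseteq> A" "finite A" "card A \<le> card (carrier F) ^ k"
    and R: "R ` sources F L LZ \<subseteq> B" "finite B" "card B \<le> card (carrier F) ^ m"
    and LZ: "k + m \<le> LZ"
    and inj: "\<And>\<omega> \<omega>'. \<omega> \<in> sources F L LZ \<Longrightarrow> \<omega>' \<in> sources F L LZ \<Longrightarrow>
      fst \<omega> = fst \<omega>' \<Longrightarrow> W \<omega> = W \<omega>' \<Longrightarrow> R \<omega> = R \<omega>' \<Longrightarrow> \<omega> = \<omega>'"
  shows "discrete_cond_entropy (card (carrier F)) (source F L LZ) fst W =
    discrete_entropy (card (carrier F)) (source F L LZ) fst"
proof -
  let ?p = "card (carrier F)" and ?M = "source F L LZ"
  have ne: "carrier F \<noteq> {}" using F(2) by auto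
  interpret information_space ?M ?p
    by (rule information_space_source[OF F])
  note sf = simple_function_source[OF F(1) ne, of L LZ]
  note space = space_source[OF F(1) ne, of L LZ]
  note chain = discrete_cond_entropy_chain[OF F, of L LZ]
  \<comment> \<open>The chain is \<open>L + LZ \<le> H(W) + H(S | W) + H(R)\<close>. The sizes of
    \<open>A\<close> and \<open>B\<close> bound \<open>H(W) + H(R)\<close> by \<open>LZ\<close>,
    which leaves at least \<open>L\<close> for \<open>H(S | W)\<close>.\<close>
  have "L + LZ = discrete_entropy ?p ?M id"
    by (simp add: entropy_source[OF F])
  also have "\<dots> \<le> discrete_entropy ?p ?M (\<lambda>\<omega>. (R \<omega>, (fst \<omega>, W \<omega>)))"
    unfolding discrete_entropy_def
    by (rule entropy_mono[OF sf sf]) (use inj in \<open>auto simp: space\<close>)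
  also have "\<dots> \<le> discrete_entropy ?p ?M W + discrete_cond_entropy ?p ?M fst W + discrete_entropy ?p ?M R"
    unfolding chain using conditional_entropy_less_eq_entropy[OF sf sf, of R "\<lambda>\<omega>. (fst \<omega>, W \<omega>)"]
    by (simp add: discrete_entropy_def discrete_cond_entropy_def)
  finally have "L \<le> discrete_cond_entropy ?p ?M fst W"
    using discrete_entropy_le[OF F W] discrete_entropy_le[OF F R] LZ by linarith
  moreover have "discrete_cond_entropy ?p ?M fst W \<le> discrete_entropy ?p ?M fst"
    unfolding discrete_entropy_def discrete_cond_entropy_def
    by (rule conditional_entropy_less_eq_entropy[OF sf sf])
  ultimately show ?thesis
    by (simp add: entropy_secret[OF F])
qed

section \<open>Solving for the noise and for the secret modulo a prime\<close>

lemma cong_add_mult_imp_eq: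
  fixes p :: int
  assumes "(a * s + z) mod p = (a * s + z') mod p" "z \<in> {0..<p}" "z' \<in> {0..<p}"
  shows "z = z'"
proof -
  have "[a * s + z = a * s + z'] (mod p)"
    using assms(1) by (simp add: cong_def)
  then have "[z = z'] (mod p)"
    by (simp add: cong_add_lcancel)
  then show ?thesis
    using assms(2,3) by (auto simp: cong_def)
qed

text \<open>Subtracting the equations eliminates the common noise and leaves
  \<open>(a - b) * (s - s')\<close> divisible by \<open>p\<close>; the ranges turn congruence into
  equality.\<close>

lemma prime_two_equations_imp_eq:
  fixes p a b s s' z z' :: int
  assumes p: "prime p" and ab: "a \<noteq> b" "a \<in> {0..<p}" "b \<in> {0..<p}"
    and s: "s \<in> {0..<p}" "s' \<in> {0..<p}"
    and "(a * s + z) mod p = (a * s' + z') mod p" "(b * s + z) mod p = (b * s' + z') mod p"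
  shows "s = s'"
proof -
  have "[(a * s + z) - (b * s + z) = (a * s' + z') - (b * s' + z')] (mod p)"
    using assms(7,8) by (intro cong_diff) (simp_all add: cong_def)
  then have "p dvd (a - b) * (s - s')"
    by (simp add: cong_iff_dvd_diff algebra_simps)
  then have "p dvd a - b \<or> p dvd s - s'"
    using p by (simp add: prime_dvd_mult_iff)
  moreover have "\<not> p dvd a - b"
    using ab zdvd_imp_le[of p "\<bar>a - b\<bar>"] by auto
  moreover have "s = s'" if "p dvd s - s'"
  proof (rule ccontr)
    assume "s \<noteq> s'"
    with that have "p \<le> \<bar>s - s'\<bar>"
      by (intro zdvd_imp_le) auto
    with s show False
      by auto
  qed
  ultimately show ?thesis
    by blast
qed

text \<open>\<open>c\<close> gives the coefficients of the secret and \<open>q\<close> selects the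
  noise symbol. Correctness solves two equations with a common noise; security is the dimension
  count.\<close>

lemma cds_scheme_linear:
  fixes I :: "('x \<times> 'y) set" and c q :: "'x + 'y \<Rightarrow> nat"
  assumes p: "prime p" and c: "\<And>v. c v < p" and q: "\<And>v. q v < n"
    and qual: "\<And>x y. (x, y) \<in> I \<Longrightarrow> f (x, y) \<Longrightarrow> q (Inl x) = q (Inr y) \<and> c (Inl x) \<noteq> c (Inr y)"
    and unqual: "\<And>x y. (x, y) \<in> I \<Longrightarrow> \<not> f (x, y) \<Longrightarrow> q (Inl x) = q (Inr y) \<Longrightarrow> c (Inl x) = c (Inr y)"
  shows "cds_scheme I f (residue_ring (int p)) 1 n (\<lambda>_. 1)
    (\<lambda>v (s, z). \<lambda>i\<in>{..<1}. (int (c v) * s 0 + z (q v)) mod int p)"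
proof -
  let ?F = "residue_ring (int p)"
  define \<sigma> :: "'x + 'y \<Rightarrow> vec \<times> vec \<Rightarrow> vec" where
    "\<sigma> v \<omega> = (\<lambda>i\<in>{..<1}. (int (c v) * fst \<omega> 0 + snd \<omega> (q v)) mod int p)" for v \<omega>
  have field: "field ?F"
    using p by (intro residues_prime.is_field) (simp add: residues_prime_def)
  have p1: "p > 1"
    using p by (rule prime_gt_1_nat)
  have carrier: "carrier ?F = {0..<int p}"
    by (auto simp: residue_ring_def)
  have fin: "finite (carrier ?F)" and card: "card (carrier ?F) = p"
    by (simp_all add: carrier)
  have card2: "card (carrier ?F) \<ge> 2"
    using p1 by (simp add: card)
  have ne: "carrier ?F \<noteq> {}"
    using p1 by (simp add: carrier)
  let ?E = "{..<1::nat} \<rightarrow>\<^sub>E carrier ?F"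
  have E: "finite ?E" "card ?E = p"
    by (simp_all only: finite_PiE finite_lessThan fin card_PiE card) simp
  have \<sigma>: "\<sigma> v \<omega> \<in> ?E" for v \<omega>
    using p1 by (auto simp: \<sigma>_def carrier)
  have \<sigma>_eq: "(int (c v) * fst \<omega> 0 + snd \<omega> (q v)) mod int p = (int (c v) * fst \<omega>' 0 + snd \<omega>' (q v)) mod int p"
    if "\<sigma> v \<omega> = \<sigma> v \<omega>'" for v \<omega> \<omega>'
    using fun_cong[OF that, of 0] by (simp add: \<sigma>_def)
  have sources: "fst \<omega> \<in> ?E" "snd \<omega> \<in> {..<n} \<rightarrow>\<^sub>E carrier ?F" if "\<omega> \<in> sources ?F 1 n" for \<omega>
    using that unfolding sources_def mem_Times_iff by blast+
  have S: "fst \<omega> 0 \<in> {0..<int p}" if "\<omega> \<in> sources ?F 1 n" for \<omega>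
    using PiE_mem[OF sources(1)[OF that], of 0] by (simp add: carrier)
  have Z: "snd \<omega> i \<in> {0..<int p}" if "\<omega> \<in> sources ?F 1 n" "i < n" for \<omega> i
    using PiE_mem[OF sources(2)[OF that(1)], of i] that(2) by (simp add: carrier)
  have correct: "discrete_cond_entropy (card (carrier ?F)) (source ?F 1 n) fst (\<lambda>\<omega>. (\<sigma> (Inl x) \<omega>, \<sigma> (Inr y) \<omega>)) = 0"
    if xy: "(x, y) \<in> I" "f (x, y)" for x y
  proof (rule discrete_cond_entropy_eq_0[OF fin card2])
    fix \<omega> \<omega>' assume \<omega>: "\<omega> \<in> sources ?F 1 n" "\<omega>' \<in> sources ?F 1 n"
      and eq: "(\<sigma> (Inl x) \<omega>, \<sigma> (Inr y) \<omega>) = (\<sigma> (Inl x) \<omega>', \<sigma> (Inr y) \<omega>')"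
    have "fst \<omega> 0 = fst \<omega>' 0"
    proof (rule prime_two_equations_imp_eq)
      show "prime (int p)" using p by simp
      show "int (c (Inl x)) \<noteq> int (c (Inr y))"
        using qual[OF xy] by simp
      show "int (c (Inl x)) \<in> {0..<int p}" "int (c (Inr y)) \<in> {0..<int p}"
        using c by simp_all
      show "fst \<omega> 0 \<in> {0..<int p}" "fst \<omega>' 0 \<in> {0..<int p}"
        using S \<omega> by blast+
      show "(int (c (Inl x)) * fst \<omega> 0 + snd \<omega> (q (Inl x))) mod int p =
          (int (c (Inl x)) * fst \<omega>' 0 + snd \<omega>' (q (Inl x))) mod int p"
        using eq \<sigma>_eq by blast
      show "(int (c (Inr y)) * fst \<omega> 0 + snd \<omega> (q (Inl x))) mod int p =
          (int (c (Inr y)) * fst \<omega>' 0 + snd \<omega>' (q (Inl x))) mod int p"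
        using eq \<sigma>_eq[of "Inr y" \<omega> \<omega>'] qual[OF xy] by simp
    qed
    then show "fst \<omega> = fst \<omega>'"
      by (intro PiE_ext[OF sources(1)[OF \<omega>(1)] sources(1)[OF \<omega>(2)]]) simp
  qed
  have secure: "discrete_cond_entropy (card (carrier ?F)) (source ?F 1 n) fst (\<lambda>\<omega>. (\<sigma> (Inl x) \<omega>, \<sigma> (Inr y) \<omega>)) =
      discrete_entropy (card (carrier ?F)) (source ?F 1 n) fst"
    if xy: "(x, y) \<in> I" "\<not> f (x, y)" for x y
  proof -
    \<comment> \<open>\<open>?J\<close> indexes the one or two noise symbols seen by the pair, and
      \<open>?R\<close> collects the others. The pair takes at most \<open>p ^ card ?J\<close>
      values: if the noise is shared, \<open>unqual\<close> makes the coefficients equal and the two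
      signals coincide.\<close>
    let ?J = "{q (Inl x), q (Inr y)}"
    let ?A = "if q (Inl x) = q (Inr y) then (\<lambda>a. (a, a)) ` ?E else ?E \<times> ?E"
    let ?R = "\<lambda>\<omega> :: vec \<times> vec. restrict (snd \<omega>) ({..<n} - ?J)"
    let ?B = "({..<n} - ?J) \<rightarrow>\<^sub>E carrier ?F"
    have J: "card ?J \<le> n" "card ({..<n} - ?J) = n - card ?J"
    proof -
      have "?J \<subseteq> {..<n}" using q by auto
      then show "card ?J \<le> n" "card ({..<n} - ?J) = n - card ?J"
        using card_mono[of "{..<n}" ?J] card_Diff_subset[of ?J "{..<n}"] by simp_all
    qed
    show ?thesis
    proof (rule discrete_cond_entropy_secret_eq[OF fin card2])
      show "(\<lambda>\<omega>. (\<sigma> (Inl x) \<omega>, \<sigma> (Inr y) \<omega>)) ` sources ?F 1 n \<subseteq> ?A"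
      proof (cases "q (Inl x) = q (Inr y)")
        case True
        then have "\<sigma> (Inl x) = \<sigma> (Inr y)"
          using unqual[OF xy] by (simp add: \<sigma>_def fun_eq_iff)
        then show ?thesis
          using True \<sigma> by auto
      qed (use \<sigma> in auto)
      show "finite ?A"
        using E by simp
      have "card ((\<lambda>a. (a, a)) ` ?E) = p"
        using E(2) by (subst card_image) (auto simp: inj_on_def)
      then show "card ?A \<le> card (carrier ?F) ^ card ?J"
        by (simp add: card card_PiE card_cartesian_product power2_eq_square)
      show "?R ` sources ?F 1 n \<subseteq> ?B"
      proof (rule image_subsetI)
        fix \<omega> assume "\<omega> \<in> sources ?F 1 n"
        from PiE_mem[OF sources(2)[OF this]] show "?R \<omega> \<in> ?B"
          unfolding restrict_PiE_iff by blast
      qed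
      show "finite ?B"
        by (simp add: finite_PiE fin)
      show "card ?B \<le> card (carrier ?F) ^ (n - card ?J)"
        using J(2) by (simp add: card_PiE)
      show "card ?J + (n - card ?J) \<le> n"
        using J(1) by simp
    next
      fix \<omega> \<omega>' assume \<omega>: "\<omega> \<in> sources ?F 1 n" "\<omega>' \<in> sources ?F 1 n" and fst: "fst \<omega> = fst \<omega>'"
        and W: "(\<sigma> (Inl x) \<omega>, \<sigma> (Inr y) \<omega>) = (\<sigma> (Inl x) \<omega>', \<sigma> (Inr y) \<omega>')" and R: "?R \<omega> = ?R \<omega>'"
      \<comment> \<open>Once the secret is fixed, each signal gives away its noise symbol.\<close>
      have eq: "snd \<omega> (q v) = snd \<omega>' (q v)" if "\<sigma> v \<omega> = \<sigma> v \<omega>'" for v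
        using cong_add_mult_imp_eq[OF \<sigma>_eq[OF that, unfolded fst] Z[OF \<omega>(1) q] Z[OF \<omega>(2) q]] .
      have "snd \<omega> i = snd \<omega>' i" if "i < n" for i
      proof (cases "i \<in> ?J")
        case True
        then show ?thesis
          using eq[of "Inl x"] eq[of "Inr y"] W by auto
      next
        case False
        then show ?thesis
          using that fun_cong[OF R, of i] by simp
      qed
      then have "snd \<omega> = snd \<omega>'"
        by (intro PiE_ext[OF sources(2)[OF \<omega>(1)] sources(2)[OF \<omega>(2)]]) simp
      with fst show "\<omega> = \<omega>'"
        by (simp add: prod_eq_iff)
    qed
  qed
  have "cds_scheme I f ?F 1 n (\<lambda>_. 1) \<sigma>"
    unfolding cds_scheme_def Let_def using field fin \<sigma> correct secure
    by (intro conjI ballI) (simp_all add: split_beta)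
  moreover have "\<sigma> = (\<lambda>v (s, z). \<lambda>i\<in>{..<1}. (int (c v) * s 0 + z (q v)) mod int p)"
    by (auto simp: \<sigma>_def fun_eq_iff)
  ultimately show ?thesis
    by simp
qed

text \<open>The number of a representative of the qualified component serves as noise index, and
  that of a representative of the unqualified class inside the component as coefficient.\<close>

lemma half_le_capacity:
  fixes I :: "('x::finite \<times> 'y::finite) set"
  assumes no_internal: "\<And>Q vs e. qualified_component I f Q \<Longrightarrow> is_path (unqualified_edges I f) vs \<Longrightarrow>
    set vs \<subseteq> Q \<Longrightarrow> \<not> internal_qualified_edge I f vs e"
  shows "ereal (1 / 2) \<le> cds_capacity I f"
proof -
  define n where "n = CARD('x + 'y)"
  obtain enum :: "'x + 'y \<Rightarrow> nat" where enum: "bij_betw enum UNIV {0..<n}"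
    using ex_bij_betw_finite_nat[of "UNIV :: ('x + 'y) set"] by (auto simp: n_def)
  have enum_less: "enum v < n" and enum_eq: "enum v = enum w \<longleftrightarrow> v = w" for v w
    using enum by (auto simp: bij_betw_def inj_eq)
  \<comment> \<open>With more residues than vertices, different representatives yield different
    coefficients modulo \<open>p\<close>.\<close>
  obtain p :: nat where p: "prime p" "n < p"
    using bigger_prime by blast
  let ?q = "adj_on UNIV (qualified_edges I f)"
  define cls where "cls v = ?q\<^sup>* `` {v}" for v
  let ?u = "\<lambda>v. adj_on (cls v) (unqualified_edges I f)"
  \<comment> \<open>Related vertices reach the same vertices, so \<open>SOME\<close> chooses from
    the same predicate and the representative depends only on the class.\<close>
  define rep where "rep r v = (SOME w. (v, w) \<in> r\<^sup>*)" for r :: "('x + 'y) rel" and v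
  have rep: "(v, rep r v) \<in> r\<^sup>*" for r v
    unfolding rep_def by (rule someI[of _ v]) simp
  have rep_eq: "rep (adj_on Q E) v = rep (adj_on Q E) w" if "(v, w) \<in> (adj_on Q E)\<^sup>*" for Q E v w
  proof -
    have "(v, x) \<in> (adj_on Q E)\<^sup>* \<longleftrightarrow> (w, x) \<in> (adj_on Q E)\<^sup>*" for x
      using that sym_rtrancl_adj_on[OF that] by (blast intro: rtrancl_trans)
    then show ?thesis
      by (simp add: rep_def)
  qed
  have rel_if_rep_eq: "(v, w) \<in> (adj_on Q E)\<^sup>*" if "rep (adj_on Q E) v = rep (adj_on Q E) w" for Q E v w
    using rep[of v "adj_on Q E"] sym_rtrancl_adj_on[OF rep[of w "adj_on Q E"]] that by (metis rtrancl_trans)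
  have cls_eq: "cls v = cls w" if "(v, w) \<in> ?q\<^sup>*" for v w
    unfolding cls_def using that sym_rtrancl_adj_on[OF that] by (blast intro: rtrancl_trans)
  have self: "v \<in> cls v" for v
    by (simp add: cls_def)
  have "cds_scheme I f (residue_ring (int p)) 1 n (\<lambda>_. 1)
    (\<lambda>v (s, z). \<lambda>i\<in>{..<1}. (int (enum (rep (?u v) v)) * s 0 + z (enum (rep ?q v))) mod int p)"
  proof (rule cds_scheme_linear[OF p(1)])
    show "enum (rep (?u v) v) < p" for v
      using enum_less p(2) less_trans by blast
    show "enum (rep ?q v) < n" for v
      by (rule enum_less)
    fix x y
    assume "(x, y) \<in> I" "f (x, y)"
    then have e: "{Inl x, Inr y} \<in> qualified_edges I f"
      by (auto simp: qualified_edges_def graph_edges_def)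
    then have q: "(Inl x, Inr y) \<in> ?q\<^sup>*"
      by (auto simp: adj_on_def)
    \<comment> \<open>Equal coefficients would join the two ends by an unqualified path inside their
      component, making this edge internal.\<close>
    have "rep (?u (Inl x)) (Inl x) \<noteq> rep (?u (Inr y)) (Inr y)"
    proof
      assume "rep (?u (Inl x)) (Inl x) = rep (?u (Inr y)) (Inr y)"
      then have "(Inl x, Inr y) \<in> (?u (Inl x))\<^sup>*"
        using rel_if_rep_eq cls_eq[OF q] by metis
      then obtain vs where vs: "is_path (unqualified_edges I f) vs" "set vs \<subseteq> cls (Inl x)"
          "hd vs = Inl x" "last vs = Inr y"
        using ex_is_path[of "Inl x" "Inr y" "cls (Inl x)"] cls_eq[OF q] self by blast
      then have "internal_qualified_edge I f vs {Inl x, Inr y}"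
        using e hd_in_set[of vs] last_in_set[of vs] by (auto simp: internal_qualified_edge_def is_path_def)
      then show False
        using no_internal[OF _ vs(1,2)] qualified_component_Image[of I f "Inl x"] by (simp add: cls_def)
    qed
    then show "enum (rep ?q (Inl x)) = enum (rep ?q (Inr y)) \<and>
        enum (rep (?u (Inl x)) (Inl x)) \<noteq> enum (rep (?u (Inr y)) (Inr y))"
      using rep_eq[OF q] by (simp add: enum_eq)
  next
    fix x y
    assume "(x, y) \<in> I" "\<not> f (x, y)" "enum (rep ?q (Inl x)) = enum (rep ?q (Inr y))"
    then have e: "{Inl x, Inr y} \<in> unqualified_edges I f" and q: "(Inl x, Inr y) \<in> ?q\<^sup>*"
      by (auto simp: unqualified_edges_def graph_edges_def enum_eq intro: rel_if_rep_eq)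
    \<comment> \<open>Sharing the noise means lying in the same component, so the edge itself puts
      both ends into one unqualified class.\<close>
    have "(Inl x, Inr y) \<in> ?u (Inl x)"
      using e self cls_eq[OF q] by (auto simp: adj_on_def)
    then show "enum (rep (?u (Inl x)) (Inl x)) = enum (rep (?u (Inr y)) (Inr y))"
      using rep_eq[OF r_into_rtrancl] cls_eq[OF q] by metis
  qed
  then have "(\<chi> v. real 1 / real 1) \<in> achievable_tuples I f"
    unfolding achievable_tuples_def by (intro CollectI exI conjI) (rule refl)
  then have "(\<chi> v. real 1 / real 1) \<in> capacity_region I f"
    unfolding capacity_region_def by (rule closure_subset[THEN subsetD])
  then have "1 / 2 \<in> achievable_rates I f"
    unfolding achievable_rates_def by (intro CollectI exI[of _ 1]) auto
  then show ?thesis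
    unfolding cds_capacity_def by (rule SUP_upper)
qed

theorem theorem1:
  fixes I :: "('x::finite \<times> 'y::finite) set" and f :: "'x \<times> 'y \<Rightarrow> bool"
  assumes "non_degenerate I f"
    and "qualified_edges I f \<noteq> {}"
  shows "cds_capacity I f = ereal (1 / 2) \<longleftrightarrow>
    (\<forall>Q vs. qualified_component I f Q \<longrightarrow> is_path (unqualified_edges I f) vs \<longrightarrow> set vs \<subseteq> Q \<longrightarrow>
       \<not> (\<exists>e. internal_qualified_edge I f vs e))"
proof
  assume "cds_capacity I f = ereal (1 / 2)"
  then show "\<forall>Q vs. qualified_component I f Q \<longrightarrow> is_path (unqualified_edges I f) vs \<longrightarrow> set vs \<subseteq> Q \<longrightarrow>
      \<not> (\<exists>e. internal_qualified_edge I f vs e)"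
    using capacity_less_half[OF assms(1)] by (metis less_irrefl)
next
  assume "\<forall>Q vs. qualified_component I f Q \<longrightarrow> is_path (unqualified_edges I f) vs \<longrightarrow> set vs \<subseteq> Q \<longrightarrow>
      \<not> (\<exists>e. internal_qualified_edge I f vs e)"
  then have "ereal (1 / 2) \<le> cds_capacity I f"
    by (intro half_le_capacity) blast
  with capacity_le_half[OF assms] show "cds_capacity I f = ereal (1 / 2)"
    by (rule antisym)
qed

end
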